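(* The structure $\mathbb R^{\mathrm o}=(\mathbb R^{\mathbb N},+,\cdot,=_{\mathcal F},<_{\mathcal F})$ of all sequences of real numbers, with termwise addition and multiplication, with equality taken to be $=_{\mathcal F}$ and with strict order $<_{\mathcal F}$, is a partially ordered non-Archimedean commutative ring.
   Context: For sequences $(a_n),(b_n)\in\mathbb R^{\mathbb N}$: $(a_n)+(b_n)=(a_n+b_n)$ and $(a_n)\cdot(b_n)=(a_nb_n)$; $(a_n)=_{\mathcal F}(b_n)$ iff there is $m\in\mathbb N$ such that $a_n=b_n$ for all $n>m$; $(a_n)<_{\mathcal F}(b_n)$ iff there is $m\in\mathbb N$ such that $a_n<b_n$ for all $n>m$. Using $=_{\mathcal F}$ as the equality of the structure means that sequences are identified when they agree from some index on; equivalently, the structure is the quotient $\mathbb R^{\mathbb N}/\mathcal F$ of $\mathbb R^{\mathbb N}$ by the Fréchet filter $\mathcal F$ (the filter of cofinite subsets of $\mathbb N$) with the induced operations and order. The zero is $(0,0,0,\dots)$ and the unit is $(1,1,1,\dots)$. "Partially ordered" refers to the strict partial order $<_{\mathcal F}$ (irreflexive and transitive), compatible with the ring operations in the usual sense of ordered rings. "Non-Archimedean" means that there are elements $a,b$ with $0<_{\mathcal F}a$ such that $k\cdot a<_{\mathcal F}b$ for every $k\in\mathbb N$. *)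

theory Defs
  imports Complex_Main "HOL-Algebra.Ring"
begin

definition frechet_eq :: "((nat \<Rightarrow> real) \<times> (nat \<Rightarrow> real)) set" where
  "frechet_eq = {(a, b). \<exists>m. \<forall>n>m. a n = b n}"

definition frechet_less :: "(nat \<Rightarrow> real) \<Rightarrow> (nat \<Rightarrow> real) \<Rightarrow> bool" where
  "frechet_less a b \<longleftrightarrow> (\<exists>m. \<forall>n>m. a n < b n)"

definition seq_add :: "(nat \<Rightarrow> real) \<Rightarrow> (nat \<Rightarrow> real) \<Rightarrow> nat \<Rightarrow> real" where
  "seq_add a b = (\<lambda>n. a n + b n)"

definition seq_mult :: "(nat \<Rightarrow> real) \<Rightarrow> (nat \<Rightarrow> real) \<Rightarrow> nat \<Rightarrow> real" where
  "seq_mult a b = (\<lambda>n. a n * b n)"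

abbreviation frechet_class :: "(nat \<Rightarrow> real) \<Rightarrow> (nat \<Rightarrow> real) set" where
  "frechet_class a \<equiv> frechet_eq `` {a}"

text \<open>
  Taking \<^const>\<open>frechet_eq\<close> as the equality of the structure amounts to passing to the
  quotient. The operations and the order on classes are induced by representatives; the
  definitions below do not presuppose that the choice of representatives is immaterial.
\<close>

definition Ro :: "(nat \<Rightarrow> real) set ring" where
  "Ro = \<lparr>carrier = UNIV // frechet_eq,
    monoid.mult = (\<lambda>A B. \<Union>a\<in>A. \<Union>b\<in>B. frechet_class (seq_mult a b)),
    one = frechet_class (\<lambda>n. 1),
    zero = frechet_class (\<lambda>n. 0),
    add = (\<lambda>A B. \<Union>a\<in>A. \<Union>b\<in>B. frechet_class (seq_add a b))\<rparr>"

definition Ro_less :: "(nat \<Rightarrow> real) set \<Rightarrow> (nat \<Rightarrow> real) set \<Rightarrow> bool" where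
  "Ro_less A B \<longleftrightarrow> (\<exists>a\<in>A. \<exists>b\<in>B. frechet_less a b)"

locale partially_ordered_cring = cring R for R (structure) +
  fixes lt :: "'a \<Rightarrow> 'a \<Rightarrow> bool"
  assumes lt_irrefl: "irreflp_on (carrier R) lt"
    and lt_trans: "transp_on (carrier R) lt"
    and add_strict_mono: "\<lbrakk>x \<in> carrier R; y \<in> carrier R; z \<in> carrier R; lt x y\<rbrakk>
      \<Longrightarrow> lt (x \<oplus> z) (y \<oplus> z)"
    and mult_pos: "\<lbrakk>x \<in> carrier R; y \<in> carrier R; lt \<zero> x; lt \<zero> y\<rbrakk>
      \<Longrightarrow> lt \<zero> (x \<otimes> y)"

definition non_archimedean :: "('a, 'm) ring_scheme \<Rightarrow> ('a \<Rightarrow> 'a \<Rightarrow> bool) \<Rightarrow> bool" where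
  "non_archimedean R lt \<longleftrightarrow>
    (\<exists>a\<in>carrier R. \<exists>b\<in>carrier R. lt \<zero>\<^bsub>R\<^esub> a \<and> (\<forall>k::nat. lt ([k] \<cdot>\<^bsub>R\<^esub> a) b))"

end

theory Submission
  imports Defs
begin

text \<open>Equality and order of sequences both say that a pointwise relation of reals holds
  eventually. Since the Frechet filter is closed under finite intersections and supersets, sums,
  products and order descend to classes (\<open>frechet_class_eq_iff\<close>,
  \<open>frechet_less_cong\<close>), and the laws of the reals carry over index by index:
  \<open>Ro_simps\<close> computes with representatives. Irreflexivity also uses that the filter is
  proper. The identity sequence eventually exceeds every constant sequence, so it lies above all
  multiples of the unit.\<close>

lemma ex_all_greater_iff_eventually:
  fixes P :: "nat \<Rightarrow> bool"
  shows "(\<exists>m. \<forall>n>m. P n) \<longleftrightarrow> eventually P sequentially"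
  by (simp add: eventually_at_top_dense)

lemma frechet_eq_iff: "(a, b) \<in> frechet_eq \<longleftrightarrow> (\<forall>\<^sub>F n in sequentially. a n = b n)"
  by (simp add: frechet_eq_def ex_all_greater_iff_eventually)

lemma frechet_less_iff: "frechet_less a b \<longleftrightarrow> (\<forall>\<^sub>F n in sequentially. a n < b n)"
  by (simp add: frechet_less_def ex_all_greater_iff_eventually)

lemma equiv_frechet_eq: "equiv UNIV frechet_eq"
proof (rule equivI)
  show "refl frechet_eq" by (simp add: refl_on_def frechet_eq_iff)
  show "sym frechet_eq" by (simp add: sym_def frechet_eq_iff eq_commute)
  show "trans frechet_eq"
    unfolding trans_def frechet_eq_iff by (auto elim: eventually_elim2)
qed simp

lemma frechet_class_eq_iff: "frechet_class a = frechet_class b \<longleftrightarrow> (a, b) \<in> frechet_eq"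
  using eq_equiv_class_iff[OF equiv_frechet_eq] by simp

text \<open>Two eventual equalities hold jointly from some index on, and there the sums agree; the
  same argument serves for products.\<close>

lemma seq_add_respects: "(\<lambda>a b. frechet_class (seq_add a b)) respects2 frechet_eq"
  by (rule congruent2I')
    (auto simp: frechet_class_eq_iff frechet_eq_iff seq_add_def elim: eventually_elim2)

lemma seq_mult_respects: "(\<lambda>a b. frechet_class (seq_mult a b)) respects2 frechet_eq"
  by (rule congruent2I')
    (auto simp: frechet_class_eq_iff frechet_eq_iff seq_mult_def elim: eventually_elim2)

lemma frechet_less_cong:
  assumes "(a, a') \<in> frechet_eq" "(b, b') \<in> frechet_eq"
  shows "frechet_less a b \<longleftrightarrow> frechet_less a' b'"
proof -
  have "\<forall>\<^sub>F n in sequentially. a n < b n \<longleftrightarrow> a' n < b' n"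
    using assms unfolding frechet_eq_iff by (auto elim: eventually_elim2)
  then show ?thesis unfolding frechet_less_iff by (rule eventually_cong)
qed

lemma frechet_less_respects: "frechet_less respects2 frechet_eq"
  using frechet_less_cong by (auto simp: congruent2_def)

lemma Ro_carrier_cases:
  assumes "A \<in> carrier Ro"
  obtains a where "A = frechet_class a"
  using assms by (auto simp: Ro_def quotient_def)

lemma frechet_class_in_carrier: "frechet_class a \<in> carrier Ro"
  by (auto simp: Ro_def quotient_def)

text \<open>By congruence all representatives yield the same class, so the union defining the sum
  collapses to that one class.\<close>

lemma Ro_add: "frechet_class a \<oplus>\<^bsub>Ro\<^esub> frechet_class b = frechet_class (\<lambda>n. a n + b n)"
  using UN_equiv_class2[OF equiv_frechet_eq equiv_frechet_eq seq_add_respects]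
  by (simp add: Ro_def seq_add_def)

lemma Ro_mult: "frechet_class a \<otimes>\<^bsub>Ro\<^esub> frechet_class b = frechet_class (\<lambda>n. a n * b n)"
  using UN_equiv_class2[OF equiv_frechet_eq equiv_frechet_eq seq_mult_respects]
  by (simp add: Ro_def seq_mult_def)

lemma Ro_zero: "\<zero>\<^bsub>Ro\<^esub> = frechet_class (\<lambda>n. 0)"
  and Ro_one: "\<one>\<^bsub>Ro\<^esub> = frechet_class (\<lambda>n. 1)"
  by (simp_all add: Ro_def)

text \<open>\<open>Ro_less\<close> only asks for some pair of representatives;
  \<open>frechet_less_cong\<close> moves the inequality from that pair to the given one.\<close>

lemma Ro_less_frechet_class: "Ro_less (frechet_class a) (frechet_class b) \<longleftrightarrow> frechet_less a b"
proof
  assume "Ro_less (frechet_class a) (frechet_class b)"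
  then show "frechet_less a b"
    using frechet_less_cong by (auto simp: Ro_less_def)
next
  have "a \<in> frechet_class a" "b \<in> frechet_class b"
    by (simp_all add: frechet_eq_iff)
  moreover assume "frechet_less a b"
  ultimately show "Ro_less (frechet_class a) (frechet_class b)"
    unfolding Ro_less_def by blast
qed

lemmas Ro_simps = Ro_add Ro_mult Ro_zero Ro_one Ro_less_frechet_class

lemma cring_Ro: "cring Ro"
proof (rule cringI)
  show "abelian_group Ro"
  proof (rule abelian_groupI)
    fix x assume "x \<in> carrier Ro"
    then obtain a where x: "x = frechet_class a" by (rule Ro_carrier_cases)
    have "frechet_class (\<lambda>n. - a n) \<oplus>\<^bsub>Ro\<^esub> x = \<zero>\<^bsub>Ro\<^esub>"
      by (simp add: x Ro_simps)
    then show "\<exists>y\<in>carrier Ro. y \<oplus>\<^bsub>Ro\<^esub> x = \<zero>\<^bsub>Ro\<^esub>"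
      using frechet_class_in_carrier by blast
  qed (auto elim!: Ro_carrier_cases simp: Ro_simps frechet_class_in_carrier algebra_simps)
  show "comm_monoid Ro"
    by (rule comm_monoidI)
      (auto elim!: Ro_carrier_cases simp: Ro_simps frechet_class_in_carrier algebra_simps)
qed (auto elim!: Ro_carrier_cases simp: Ro_simps algebra_simps)

lemma partially_ordered_cring_Ro: "partially_ordered_cring Ro Ro_less"
proof (intro partially_ordered_cring.intro cring_Ro partially_ordered_cring_axioms.intro)
  \<comment> \<open>A class below itself would make \<open>a n < a n\<close> hold eventually, which
    is impossible because \<open>sequentially\<close> is not the trivial filter.\<close>
  show "irreflp_on (carrier Ro) Ro_less"
    by (auto intro!: irreflp_onI elim!: Ro_carrier_cases simp: Ro_simps frechet_less_iff)
  show "transp_on (carrier Ro) Ro_less"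
  proof (rule transp_onI)
    fix x y z
    assume "x \<in> carrier Ro" "y \<in> carrier Ro" "z \<in> carrier Ro" "Ro_less x y" "Ro_less y z"
    then show "Ro_less x z"
      by (elim Ro_carrier_cases) (auto simp: Ro_simps frechet_less_iff elim: eventually_elim2)
  qed
next
  fix x y z
  assume "x \<in> carrier Ro" "y \<in> carrier Ro" "z \<in> carrier Ro" "Ro_less x y"
  then show "Ro_less (x \<oplus>\<^bsub>Ro\<^esub> z) (y \<oplus>\<^bsub>Ro\<^esub> z)"
    by (elim Ro_carrier_cases) (simp add: Ro_simps frechet_less_iff)
next
  fix x y
  assume "x \<in> carrier Ro" "y \<in> carrier Ro" "Ro_less \<zero>\<^bsub>Ro\<^esub> x" "Ro_less \<zero>\<^bsub>Ro\<^esub> y"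
  then show "Ro_less \<zero>\<^bsub>Ro\<^esub> (x \<otimes>\<^bsub>Ro\<^esub> y)"
    by (elim Ro_carrier_cases) (auto simp: Ro_simps frechet_less_iff elim: eventually_elim2)
qed

lemma Ro_add_pow: "[k] \<cdot>\<^bsub>Ro\<^esub> frechet_class a = frechet_class (\<lambda>n. real k * a n)"
  by (induction k) (simp_all add: add_pow_def nat_pow_def Ro_simps algebra_simps)

lemma non_archimedean_Ro: "non_archimedean Ro Ro_less"
  unfolding non_archimedean_def
proof (intro bexI conjI allI)
  \<comment> \<open>The witnesses are the unit and the class of \<open>real\<close>, the sequence 0,
    1, 2, ...: its terms exceed \<open>k\<close> at every index beyond \<open>k\<close>.\<close>
  show "Ro_less \<zero>\<^bsub>Ro\<^esub> (frechet_class (\<lambda>n. 1))"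
    by (simp add: Ro_simps frechet_less_iff)
  show "Ro_less ([k] \<cdot>\<^bsub>Ro\<^esub> frechet_class (\<lambda>n. 1)) (frechet_class real)" for k :: nat
    by (simp add: Ro_add_pow Ro_simps frechet_less_iff eventually_gt_at_top)
qed (rule frechet_class_in_carrier)+

text \<open>The congruence statements stand beside the algebraic ones because the definitions of
  \<open>Ro\<close> and \<open>Ro_less\<close> make sense without them; they certify that the
  operations and the order are truly induced from sequences.\<close>

theorem theorem6:
  shows "equiv UNIV frechet_eq
    \<and> (\<lambda>a b. frechet_class (seq_add a b)) respects2 frechet_eq
    \<and> (\<lambda>a b. frechet_class (seq_mult a b)) respects2 frechet_eq
    \<and> frechet_less respects2 frechet_eq
    \<and> partially_ordered_cring Ro Ro_less
    \<and> non_archimedean Ro Ro_less"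
  using equiv_frechet_eq seq_add_respects seq_mult_respects frechet_less_respects
    partially_ordered_cring_Ro non_archimedean_Ro
  by blast

end
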